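(* Let $L>0$ and let $f:\mathbb{R}^d\to\mathbb{R}$ be differentiable. Then $f$ is convex and $L$-smooth if and only if any one of the following two conditions holds (that is, each of the two conditions is individually equivalent to $f$ being both convex and $L$-smooth): (a) $\langle\nabla f(x)-\nabla f(y),x-y\rangle\ge\frac1L\|\nabla f(x)-\nabla f(y)\|^2$ for all $x,y\in\mathbb{R}^d$; (b) $f(y)\ge f(x)+\langle\nabla f(x),y-x\rangle+\frac{1}{2L}\|\nabla f(x)-\nabla f(y)\|^2$ for all $x,y\in\mathbb{R}^d$.
   Context: $\mathbb{R}^d$ carries the dot product $\langle\cdot,\cdot\rangle$ and the induced Euclidean norm $\|\cdot\|$. For a differentiable function $h$, the Bregman distance is $D_h(x,y):=h(x)-h(y)-\langle\nabla h(y),x-y\rangle$. Let $\varphi_0=\frac12\|\cdot\|^2$. A differentiable function $f:\mathbb{R}^d\to\mathbb{R}$ is called $L$-smooth if $D_f(x,y)\le L\,D_{\varphi_0}(x,y)$ for all $x,y\in\mathbb{R}^d$. *)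

theory Defs
  imports "HOL-Analysis.Analysis"
begin

text \<open>\<^term>\<open>gradient h x\<close> is the vector representing the Frechet derivative of \<open>h\<close> at \<open>x\<close>
  through the inner product; it is unspecified where \<open>h\<close> is not differentiable.\<close>

definition gradient :: "('a::euclidean_space \<Rightarrow> real) \<Rightarrow> 'a \<Rightarrow> 'a" where
  "gradient h x = (THE D. GDERIV h x :> D)"

lemma gradient_eqI:
  assumes "GDERIV h x :> D"
  shows "gradient h x = D"
  unfolding gradient_def
proof (rule the_equality)
  show "GDERIV h x :> D" by (fact assms)
next
  fix D' assume "GDERIV h x :> D'"
  then have "(\<lambda>v. v \<bullet> D') = (\<lambda>v. v \<bullet> D)"
    using assms unfolding gderiv_def by (rule has_derivative_unique)
  then show "D' = D"
    by (metis inner_commute vector_eq_ldot)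
qed

definition bregman :: "('a::euclidean_space \<Rightarrow> real) \<Rightarrow> 'a \<Rightarrow> 'a \<Rightarrow> real" where
  "bregman h x y = h x - h y - gradient h y \<bullet> (x - y)"

definition half_sq_norm :: "'a::euclidean_space \<Rightarrow> real" where
  "half_sq_norm x = 1 / 2 * (norm x)\<^sup>2"

definition L_smooth :: "real \<Rightarrow> ('a::euclidean_space \<Rightarrow> real) \<Rightarrow> bool" where
  "L_smooth L f \<longleftrightarrow>
     (\<forall>x. f differentiable (at x)) \<and>
     (\<forall>x y. bregman f x y \<le> L * bregman half_sq_norm x y)"

end

theory Submission
  imports Defs
begin

text \<open>The implications run in a cycle: convex and \<open>L\<close>-smooth, then (b), then (a), then back.

  Convexity puts \<open>f\<close> above its tangent plane at \<open>x\<close>, and smoothness puts \<open>f\<close> below the paraboloid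
  of curvature \<open>L\<close> tangent to it at \<open>y\<close>. Hence the plane lies below the paraboloid everywhere. The
  difference of the two is smallest at \<open>y - (\<nabla>f y - \<nabla>f x) / L\<close>, and nonnegativity there is
  exactly (b) (\<open>lower_bound_of_convex_smooth\<close>). Adding (b) to itself with \<open>x\<close> and \<open>y\<close> exchanged
  cancels the function values and leaves (a).

  Condition (a) makes \<open>\<nabla>f\<close> monotone, and the Cauchy--Schwarz inequality makes it
  \<open>L\<close>-Lipschitz, so that \<open>x \<mapsto> L x - \<nabla>f x\<close> is monotone too. This is the gradient of
  \<open>L / 2 * \<parallel>x\<parallel>\<^sup>2 - f x\<close>. By the mean value theorem, a function with monotone gradient lies above
  its tangent planes (\<open>above_tangent_of_monotone_gradient\<close>); for \<open>f\<close> this yields convexity,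
  and for \<open>L / 2 * \<parallel>x\<parallel>\<^sup>2 - f x\<close> it is smoothness of \<open>f\<close>.\<close>

lemma GDERIV_gradient:
  fixes f :: "'a::euclidean_space \<Rightarrow> real"
  assumes "f differentiable (at x)"
  shows "GDERIV f x :> gradient f x"
proof -
  obtain f' where f': "(f has_derivative f') (at x)"
    using assms unfolding differentiable_def by blast
  interpret bounded_linear f'
    using f' by (rule has_derivative_bounded_linear)
  \<comment> \<open>the Riesz representative of the derivative, written out in the standard basis\<close>
  define D where "D = (\<Sum>b\<in>Basis. f' b *\<^sub>R b)"
  have "f' = (\<lambda>v. v \<bullet> D)"
  proof
    fix v
    have "f' v = f' (\<Sum>b\<in>Basis. (v \<bullet> b) *\<^sub>R b)"
      by (simp add: euclidean_representation)
    also have "\<dots> = v \<bullet> D"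
      by (simp add: sum scale D_def inner_sum_right mult.commute)
    finally show "f' v = v \<bullet> D" .
  qed
  then have "GDERIV f x :> D"
    using f' by (simp add: gderiv_def)
  then show ?thesis
    using gradient_eqI by metis
qed

lemma GDERIV_half_sq_norm: "GDERIV half_sq_norm x :> x"
  unfolding gderiv_def half_sq_norm_def power2_norm_eq_inner
  by (auto intro!: derivative_eq_intros simp: inner_commute)

lemma bregman_half_sq_norm: "bregman half_sq_norm x y = 1 / 2 * (norm (x - y))\<^sup>2"
  unfolding bregman_def gradient_eqI[OF GDERIV_half_sq_norm]
  by (simp add: half_sq_norm_def power2_norm_eq_inner inner_diff inner_commute algebra_simps)

lemma GDERIV_along_line:
  assumes "GDERIV h (y + t *\<^sub>R d) :> D"
  shows "((\<lambda>s. h (y + s *\<^sub>R d)) has_real_derivative D \<bullet> d) (at t)"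
proof -
  have "((\<lambda>s. y + s *\<^sub>R d) has_derivative (\<lambda>s. s *\<^sub>R d)) (at t)"
    by (auto intro!: derivative_eq_intros)
  from has_derivative_compose[OF this assms[unfolded gderiv_def]]
  have "((\<lambda>s. h (y + s *\<^sub>R d)) has_derivative (\<lambda>s. (s *\<^sub>R d) \<bullet> D)) (at t)" .
  then show ?thesis
    by (simp add: has_field_derivative_def inner_commute mult_commute_abs)
qed

text \<open>Restricting \<open>h\<close> to the line through \<open>y\<close> and \<open>x\<close> reduces this to the tangent of a convex
  function of one real variable.\<close>

lemma convex_on_above_tangent_plane:
  fixes h :: "'a::real_inner \<Rightarrow> real"
  assumes convex: "convex_on UNIV h" and D: "GDERIV h y :> D"
  shows "h x \<ge> h y + D \<bullet> (x - y)"
proof -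
  define \<phi> where "\<phi> t = h (y + t *\<^sub>R (x - y))" for t :: real
  have "convex_on UNIV \<phi>"
  proof (rule convex_onI)
    fix t a b :: real
    assume "0 < t" "t < 1"
    moreover have "y + ((1 - t) *\<^sub>R a + t *\<^sub>R b) *\<^sub>R (x - y)
        = (1 - t) *\<^sub>R (y + a *\<^sub>R (x - y)) + t *\<^sub>R (y + b *\<^sub>R (x - y))"
      by (simp add: algebra_simps)
    ultimately show "\<phi> ((1 - t) *\<^sub>R a + t *\<^sub>R b) \<le> (1 - t) * \<phi> a + t * \<phi> b"
      using convex_onD[OF convex, of t] unfolding \<phi>_def by simp
  qed simp
  moreover have "(\<phi> has_real_derivative D \<bullet> (x - y)) (at 0)"
    unfolding \<phi>_def by (rule GDERIV_along_line) (simp add: D)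
  ultimately have "\<phi> 1 - \<phi> 0 \<ge> D \<bullet> (x - y) * (1 - 0)"
    by (intro convex_on_imp_above_tangent[where A = UNIV]) auto
  then show ?thesis
    by (simp add: \<phi>_def)
qed

text \<open>The mean value theorem expresses the increment of \<open>h\<close> through the gradient at a point between
  \<open>y\<close> and \<open>x\<close>, and by monotonicity the slope there in direction \<open>x - y\<close> is at least that at \<open>y\<close>.\<close>

lemma above_tangent_of_monotone_gradient:
  fixes h :: "'a::real_inner \<Rightarrow> real"
  assumes grad: "\<And>x. GDERIV h x :> g x"
    and mono: "\<And>x y. (g x - g y) \<bullet> (x - y) \<ge> 0"
  shows "h x \<ge> h y + g y \<bullet> (x - y)"
proof -
  define \<phi> where "\<phi> t = h (y + t *\<^sub>R (x - y))" for t :: real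
  have "(\<phi> has_real_derivative g (y + t *\<^sub>R (x - y)) \<bullet> (x - y)) (at t)" for t
    unfolding \<phi>_def by (rule GDERIV_along_line) (rule grad)
  then obtain t where t: "0 < t" "t < 1"
    and mvt: "\<phi> 1 - \<phi> 0 = (1 - 0) * (g (y + t *\<^sub>R (x - y)) \<bullet> (x - y))"
    using MVT2[of 0 1 \<phi> "\<lambda>t. g (y + t *\<^sub>R (x - y)) \<bullet> (x - y)"] by auto
  have "0 \<le> t * ((g (y + t *\<^sub>R (x - y)) - g y) \<bullet> (x - y))"
    using mono[of "y + t *\<^sub>R (x - y)" y] by simp
  then have "g y \<bullet> (x - y) \<le> g (y + t *\<^sub>R (x - y)) \<bullet> (x - y)"
    using t by (simp add: zero_le_mult_iff inner_diff_left)
  then show ?thesis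
    using mvt by (simp add: \<phi>_def)
qed

text \<open>At the point \<open>z = (1 - t) x + t y\<close> of a segment, the two bounds by the tangent plane at \<open>z\<close>,
  averaged with weights \<open>1 - t\<close> and \<open>t\<close>, have no linear term left.\<close>

lemma convex_on_of_above_tangent:
  fixes h :: "'a::real_inner \<Rightarrow> real"
  assumes above: "\<And>x y. h x \<ge> h y + g y \<bullet> (x - y)"
  shows "convex_on UNIV h"
proof (rule convex_onI)
  fix t :: real and x y :: 'a
  assume t: "0 < t" "t < 1"
  define z where "z = (1 - t) *\<^sub>R x + t *\<^sub>R y"
  have "(1 - t) * (h z + g z \<bullet> (x - z)) + t * (h z + g z \<bullet> (y - z))
      \<le> (1 - t) * h x + t * h y"
    using t above by (intro add_mono mult_left_mono) auto
  moreover have "(1 - t) * (h z + g z \<bullet> (x - z)) + t * (h z + g z \<bullet> (y - z))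
      = h z + g z \<bullet> ((1 - t) *\<^sub>R (x - z) + t *\<^sub>R (y - z))"
    by (simp add: inner_add_right algebra_simps)
  moreover have "(1 - t) *\<^sub>R (x - z) + t *\<^sub>R (y - z) = 0"
    by (simp add: z_def algebra_simps)
  ultimately show "h ((1 - t) *\<^sub>R x + t *\<^sub>R y) \<le> (1 - t) * h x + t * h y"
    by (simp add: z_def)
qed simp

lemma lower_bound_of_convex_smooth:
  fixes f :: "'a::euclidean_space \<Rightarrow> real"
  assumes "L > 0" and convex: "convex_on UNIV f" and smooth: "L_smooth L f"
  shows "f y \<ge> f x + gradient f x \<bullet> (y - x)
           + 1 / (2 * L) * (norm (gradient f x - gradient f y))\<^sup>2"
proof -
  define d where "d = gradient f y - gradient f x"
  \<comment> \<open>the minimiser of the paraboloid at \<open>y\<close> minus the tangent plane at \<open>x\<close>\<close>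
  define z where "z = y - (1 / L) *\<^sub>R d"
  have "f differentiable (at x)"
    using smooth by (simp add: L_smooth_def)
  then have lower: "f z \<ge> f x + gradient f x \<bullet> (z - x)"
    by (intro convex_on_above_tangent_plane[OF convex] GDERIV_gradient)
  have "bregman f z y \<le> L * (1 / 2 * (norm (z - y))\<^sup>2)"
    using smooth unfolding L_smooth_def bregman_half_sq_norm by blast
  also have "\<dots> = 1 / (2 * L) * (d \<bullet> d)"
    using \<open>L > 0\<close> by (simp add: z_def dot_square_norm power2_eq_square field_simps)
  finally have upper: "f z \<le> f y + gradient f y \<bullet> (z - y) + 1 / (2 * L) * (d \<bullet> d)"
    by (simp add: bregman_def)
  have "gradient f x \<bullet> (z - x) - gradient f y \<bullet> (z - y)
      = gradient f x \<bullet> (y - x) - d \<bullet> (z - y)"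
    by (simp add: d_def inner_diff algebra_simps)
  also have "\<dots> = gradient f x \<bullet> (y - x) + 2 * (1 / (2 * L) * (d \<bullet> d))"
    by (simp add: z_def)
  finally have "f y \<ge> f x + gradient f x \<bullet> (y - x) + 1 / (2 * L) * (d \<bullet> d)"
    using lower upper by linarith
  moreover have "d \<bullet> d = (norm (gradient f x - gradient f y))\<^sup>2"
    by (simp add: d_def norm_minus_commute flip: power2_norm_eq_inner)
  ultimately show ?thesis
    by simp
qed

lemma cocoercive_of_lower_bound:
  fixes g :: "'a::real_inner \<Rightarrow> 'a"
  assumes "\<And>x y. f y \<ge> f x + g x \<bullet> (y - x) + 1 / (2 * L) * (norm (g x - g y))\<^sup>2"
  shows "(g x - g y) \<bullet> (x - y) \<ge> 1 / L * (norm (g x - g y))\<^sup>2"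
proof -
  have "f y \<ge> f x + g x \<bullet> (y - x) + 1 / (2 * L) * (norm (g x - g y))\<^sup>2"
    and "f x \<ge> f y + g y \<bullet> (x - y) + 1 / (2 * L) * (norm (g x - g y))\<^sup>2"
    using assms[of x y] assms[of y x] by (simp_all add: norm_minus_commute)
  moreover have "(g x - g y) \<bullet> (x - y) = - (g x \<bullet> (y - x)) - g y \<bullet> (x - y)"
    by (simp add: inner_diff)
  moreover have "1 / L * (norm (g x - g y))\<^sup>2 = 2 * (1 / (2 * L) * (norm (g x - g y))\<^sup>2)"
    by simp
  ultimately show ?thesis
    by linarith
qed

text \<open>For \<open>d = \<nabla>f x - \<nabla>f y\<close> and \<open>e = x - y\<close>, the Cauchy--Schwarz inequality turns the hypothesis
  into the Lipschitz bound \<open>\<parallel>d\<parallel> \<le> L \<parallel>e\<parallel>\<close>; a second use of it bounds \<open>d \<bullet> e\<close>.\<close>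

lemma inner_le_of_cocoercive:
  fixes d e :: "'a::real_inner"
  assumes "L > 0" and "d \<bullet> e \<ge> 1 / L * (norm d)\<^sup>2"
  shows "d \<bullet> e \<le> L * (norm e)\<^sup>2"
proof -
  have "1 / L * (norm d)\<^sup>2 \<le> norm d * norm e"
    using assms(2) norm_cauchy_schwarz[of d e] by linarith
  then have "norm d * norm d \<le> norm d * (L * norm e)"
    using \<open>L > 0\<close> by (simp add: field_simps power2_eq_square)
  then have "norm d \<le> L * norm e"
    using \<open>L > 0\<close> by (cases "d = 0") auto
  then have "norm d * norm e \<le> (L * norm e) * norm e"
    by (rule mult_right_mono) simp
  then show ?thesis
    using norm_cauchy_schwarz[of d e] by (simp add: power2_eq_square)
qed

lemma convex_smooth_of_cocoercive:
  fixes f :: "'a::euclidean_space \<Rightarrow> real"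
  assumes "L > 0" and diff: "\<And>x. f differentiable (at x)"
    and coco: "\<And>x y. (gradient f x - gradient f y) \<bullet> (x - y)
                  \<ge> 1 / L * (norm (gradient f x - gradient f y))\<^sup>2"
  shows "convex_on UNIV f" and "L_smooth L f"
proof -
  have grad: "GDERIV f x :> gradient f x" for x
    using diff by (rule GDERIV_gradient)
  have "(gradient f x - gradient f y) \<bullet> (x - y) \<ge> 0" for x y
    using \<open>L > 0\<close> by (intro order_trans[OF _ coco]) simp
  then show "convex_on UNIV f"
    by (intro convex_on_of_above_tangent[where g = "gradient f"]
        above_tangent_of_monotone_gradient grad)
next
  define h where "h x = L * half_sq_norm x - f x" for x
  define g where "g x = L *\<^sub>R x - gradient f x" for x
  have grad: "GDERIV h x :> g x" for x
  proof -
    have "GDERIV (\<lambda>x. L * half_sq_norm x) x :> L *\<^sub>R x"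
      using GDERIV_mult[OF GDERIV_const GDERIV_half_sq_norm, of L x] by simp
    then show ?thesis
      unfolding h_def[abs_def] g_def by (rule GDERIV_diff) (intro GDERIV_gradient diff)
  qed
  have "(g x - g y) \<bullet> (x - y) \<ge> 0" for x y
  proof -
    have "(g x - g y) \<bullet> (x - y)
        = L * (norm (x - y))\<^sup>2 - (gradient f x - gradient f y) \<bullet> (x - y)"
      by (simp add: g_def power2_norm_eq_inner inner_diff algebra_simps)
    with inner_le_of_cocoercive[OF \<open>L > 0\<close> coco] show ?thesis
      by simp
  qed
  then have "h x \<ge> h y + g y \<bullet> (x - y)" for x y
    by (intro above_tangent_of_monotone_gradient grad)
  then have "bregman f x y \<le> L * bregman half_sq_norm x y" for x y
    unfolding bregman_def gradient_eqI[OF GDERIV_half_sq_norm] h_def g_def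
    by (simp add: algebra_simps)
  then show "L_smooth L f"
    using diff by (simp add: L_smooth_def)
qed

theorem corollary3p2:
  fixes f :: "real ^ 'n \<Rightarrow> real" and L :: real
  assumes "L > 0"
    and "\<forall>x. f differentiable (at x)"
  shows "((convex_on UNIV f \<and> L_smooth L f) \<longleftrightarrow>
           (\<forall>x y. (gradient f x - gradient f y) \<bullet> (x - y)
                    \<ge> 1 / L * (norm (gradient f x - gradient f y))\<^sup>2)) \<and>
         ((convex_on UNIV f \<and> L_smooth L f) \<longleftrightarrow>
           (\<forall>x y. f y \<ge> f x + gradient f x \<bullet> (y - x)
                    + 1 / (2 * L) * (norm (gradient f x - gradient f y))\<^sup>2))"
    (is "(?C \<longleftrightarrow> ?A) \<and> (?C \<longleftrightarrow> ?B)")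
proof -
  have "?B" if "?C"
    using lower_bound_of_convex_smooth[OF \<open>L > 0\<close>] that by blast
  moreover have "?A" if "?B"
    using cocoercive_of_lower_bound[of f "gradient f" L] that by blast
  moreover have "?C" if "?A"
    using convex_smooth_of_cocoercive[OF \<open>L > 0\<close>, of f] assms(2) that by blast
  ultimately show ?thesis
    by blast
qed

end
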